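(* Let $\boldsymbol{f}^n \in \mathbb{R}_+^N$ with $\|\boldsymbol{f}^n\|_1 = V$, let $\boldsymbol{f}(t_{n+1})$ be the exact solution at time $t_{n+1}$ of the ODE system started from $\boldsymbol{f}^n$ at time $t_n$ (see context), and let $\boldsymbol{f}^{n+1}$ be a numerical approximation produced by a positive and conservative scheme, i.e. $\boldsymbol{f}^{n+1} \in \mathbb{R}_+^N$ and $\|\boldsymbol{f}^{n+1}\|_1 = \|\boldsymbol{f}(t_{n+1})\|_1 = V$. Suppose that $\eta(\boldsymbol{f}^{n+1}) > \eta(\boldsymbol{f}^n)$ and that $\beta \in (0,1]$ satisfies $$\eta\big(\boldsymbol{f}^{n+1} + \beta(\boldsymbol{1} - \boldsymbol{f}^{n+1})\big) = \eta(\boldsymbol{f}(t_{n+1})).$$ If $\|\boldsymbol{f}(t_{n+1}) - \boldsymbol{f}^{n+1}\|_\infty \le 1/3$, then $$\|\beta(\boldsymbol{1} - \boldsymbol{f}^{n+1})\|_2 \le M\, \|\boldsymbol{f}(t_{n+1}) - \boldsymbol{f}^{n+1}\|_\infty,$$ where $M > 0$ is a constant which depends only on $V$, $\|\boldsymbol{f}^{n+1}\|_\infty$ and $\|\boldsymbol{f}(t_{n+1})\|_\infty$.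
   Context: $N \ge 1$ is an integer, $\Delta v_1,\dots,\Delta v_N > 0$ are fixed weights, $V = \sum_{i=1}^N \Delta v_i$, $\boldsymbol{1} = (1,\dots,1)^T$, and $\mathbb{R}_+ = [0,\infty)$. Norms are weighted: $\|\boldsymbol{f}\|_p = \big(\sum_{i=1}^N |f_i|^p \Delta v_i\big)^{1/p}$ for $p=1,2$, and $\|\boldsymbol{f}\|_\infty = \max_i |f_i|$. The Gibbs entropy is $\eta(\boldsymbol{f}) = \sum_{i=1}^N f_i \log f_i\, \Delta v_i$, with $0\log 0 = 0$. The ODE system is $\frac{\mathrm{d} f_i}{\mathrm{d}t} = Q_i(\boldsymbol{f}(t))$, $i=1,\dots,N$. It is assumed that its solutions (with nonnegative initial data) have the properties: conservation of mass, $\frac{\mathrm{d}}{\mathrm{d}t}\sum_i f_i(t)\Delta v_i = 0$; nonnegativity, $f_i(t) \ge 0$; monotonicity of entropy, $\frac{\mathrm{d}}{\mathrm{d}t}\sum_i f_i(t)\log f_i(t)\Delta v_i \le 0$, i.e. $\eta(\boldsymbol{f}(t))$ is nonincreasing in $t$. Here $t_n < t_{n+1}$ and $\boldsymbol{f}(t)$ denotes the solution with $\boldsymbol{f}(t_n) = \boldsymbol{f}^n$; in particular $\eta(\boldsymbol{f}(t_{n+1})) \le \eta(\boldsymbol{f}^n)$. All vectors are normalized so that the weighted average of their components is $1$, i.e. $\|\cdot\|_1 = V$. *)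

theory Defs
  imports Complex_Main "Jordan_Normal_Form.Matrix"
begin

text \<open>A vector of length \<open>N\<close> is an element of \<^term>\<open>carrier_vec N :: real vec set\<close>, so that \<open>N\<close> can be
  quantified inside a formula. Components are indexed by \<open>0, \<dots>, N - 1\<close>; the weights \<open>\<Delta>v\<close> are the
  components of a vector \<open>w\<close>.\<close>

definition nonneg_vecs :: "nat \<Rightarrow> real vec set" where
  "nonneg_vecs N = {f \<in> carrier_vec N. \<forall>i<N. 0 \<le> f $ i}"

definition pos_vecs :: "nat \<Rightarrow> real vec set" where
  "pos_vecs N = {f \<in> carrier_vec N. \<forall>i<N. 0 < f $ i}"

definition ones_vec :: "nat \<Rightarrow> real vec" where
  "ones_vec N = vec N (\<lambda>_. 1)"

definition volume :: "real vec \<Rightarrow> real" where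
  "volume w = (\<Sum>i<dim_vec w. w $ i)"

definition mass :: "real vec \<Rightarrow> real vec \<Rightarrow> real" where
  "mass w f = (\<Sum>i<dim_vec w. f $ i * w $ i)"

definition weighted_norm :: "nat \<Rightarrow> real vec \<Rightarrow> real vec \<Rightarrow> real" where
  "weighted_norm p w f = root p (\<Sum>i<dim_vec w. \<bar>f $ i\<bar> ^ p * w $ i)"

definition sup_norm :: "real vec \<Rightarrow> real" where
  "sup_norm f = Max ((\<lambda>i. \<bar>f $ i\<bar>) ` {..<dim_vec f})"

text \<open>The convention \<open>0 log 0 = 0\<close> holds since the factor \<open>f $ i\<close> vanishes.\<close>

definition entropy :: "real vec \<Rightarrow> real vec \<Rightarrow> real" where
  "entropy w f = (\<Sum>i<dim_vec w. f $ i * ln (f $ i) * w $ i)"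

text \<open>\<open>f\<close> solves the autonomous system \<open>f\<^sub>i' = Q\<^sub>i(f)\<close>, \<open>i < N\<close>, on the interval \<open>[a, b]\<close>, with one-sided
  derivatives at the end points.\<close>

definition ode_solution ::
  "nat \<Rightarrow> (nat \<Rightarrow> real vec \<Rightarrow> real) \<Rightarrow> real \<Rightarrow> real \<Rightarrow> (real \<Rightarrow> real vec) \<Rightarrow> bool" where
  "ode_solution N Q a b f \<longleftrightarrow>
     (\<forall>t\<in>{a..b}. f t \<in> carrier_vec N \<and>
       (\<forall>i<N. ((\<lambda>s. f s $ i) has_real_derivative Q i (f t)) (at t within {a..b})))"

text \<open>The standing assumption on the system. Entropy decay is stated as monotonicity along the
  solution, because the entropy need not be differentiable where a component vanishes.\<close>

definition structure_preserving :: "real vec \<Rightarrow> (nat \<Rightarrow> real vec \<Rightarrow> real) \<Rightarrow> bool" where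
  "structure_preserving w Q \<longleftrightarrow>
     (\<forall>a b f. a < b \<and> ode_solution (dim_vec w) Q a b f \<and> f a \<in> nonneg_vecs (dim_vec w) \<longrightarrow>
        (\<forall>t\<in>{a..b}. ((\<lambda>s. mass w (f s)) has_real_derivative 0) (at t within {a..b})) \<and>
        (\<forall>t\<in>{a..b}. f t \<in> nonneg_vecs (dim_vec w)) \<and>
        (\<forall>s\<in>{a..b}. \<forall>t\<in>{a..b}. s \<le> t \<longrightarrow> entropy w (f t) \<le> entropy w (f s)))"

end

theory Submission
  imports Defs "HOL-Analysis.L2_Norm"
begin

text \<open>Only \<open>\<eta>(f\<^sup>n\<^sup>+\<^sup>1 + \<beta>(1 - f\<^sup>n\<^sup>+\<^sup>1)) = \<eta>(f(t\<^sub>n\<^sub>+\<^sub>1))\<close> and the equality of masses matter. Write \<open>h = f\<^sup>n\<^sup>+\<^sup>1\<close>,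
  \<open>g = f(t\<^sub>n\<^sub>+\<^sub>1)\<close>, let \<open>\<delta>\<close> be their sup distance, and replace \<open>x log x\<close> by \<open>\<psi> x = x log x - x + 1\<close>, which
  changes all entropies by the same amount. If \<open>\<beta> \<le> 3\<delta>/2\<close> there is nothing to prove. Otherwise pass
  through the intermediate point \<open>k = h + (3\<delta>/2)(1 - h)\<close>. Where \<open>h < 1/3\<close>, the logarithmic singularity
  of the entropy is harmless because \<open>g \<le> k \<le> 1\<close> and \<open>\<psi>\<close> decreases on \<open>[0, 1]\<close>; where \<open>h \<ge> 1/3\<close>, a
  tangent estimate gives \<open>\<psi> k - \<psi> g \<le> 3\<delta>\<bar>1 - h\<bar>\<close>. Moving on from \<open>k\<close> to \<open>h + \<beta>(1 - h)\<close> decreases \<open>\<psi>\<close>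
  by at least a multiple of \<open>(\<beta> - 3\<delta>/2)(1 - h)\<^sup>2\<close>, by convexity. Summing and applying Cauchy-Schwarz
  bounds \<open>(\<beta> - 3\<delta>/2) \<parallel>1 - h\<parallel>\<^sub>2\<close> by a multiple of \<open>\<delta>\<close>.\<close>

section \<open>Pointwise inequalities for \<open>rel_ent\<close>, the function \<psi> of the
  overview\<close>

definition rel_ent :: "real \<Rightarrow> real" where
  "rel_ent x = x * ln x - x + 1"

text \<open>Convexity, with \<open>ln\<close> as the derivative: for x > 0, multiply ln (y / x)
  \<le> y / x - 1 by x.\<close>

lemma rel_ent_tangent:
  assumes "0 \<le> x" "0 < y"
  shows "rel_ent y + ln y * (x - y) \<le> rel_ent x"
proof (cases "x = 0")
  case False
  then have x: "0 < x" using assms by simp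
  have "x * (ln y - ln x) \<le> x * (y / x - 1)"
    using ln_le_minus_one[of "y / x"] x assms by (intro mult_left_mono) (auto simp: ln_div)
  also have "\<dots> = y - x" using x by (simp add: field_simps)
  finally show ?thesis by (simp add: rel_ent_def algebra_simps)
qed (use assms in \<open>simp add: rel_ent_def\<close>)

lemma rel_ent_antimono:
  assumes "0 \<le> x" "x \<le> y" "y \<le> 1"
  shows "rel_ent y \<le> rel_ent x"
proof (cases "y = 0")
  case False
  then have y: "0 < y" using assms by simp
  have "0 \<le> ln y * (x - y)"
    using y assms by (intro mult_nonpos_nonpos) auto
  with rel_ent_tangent[OF assms(1) y] show ?thesis by simp
qed (use assms in simp)

text \<open>Jensen's inequality between x and the minimiser 1, where \<open>rel_ent\<close>
  vanishes; it is the average of the tangent inequalities at the mixed point.\<close>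

lemma rel_ent_mix_le:
  assumes "0 \<le> x" "0 \<le> t" "t \<le> 1"
  shows "rel_ent (x + t * (1 - x)) \<le> (1 - t) * rel_ent x"
proof (cases "t = 0")
  case False
  define y where "y = x + t * (1 - x)"
  have y_alt: "y = (1 - t) * x + t" by (simp add: y_def algebra_simps)
  have y: "0 < y" unfolding y_alt using False assms by (intro add_nonneg_pos) auto
  have "(1 - t) * (rel_ent y + ln y * (x - y)) + t * (rel_ent y + ln y * (1 - y))
      \<le> (1 - t) * rel_ent x + t * rel_ent 1"
    using assms y by (intro add_mono mult_left_mono rel_ent_tangent) auto
  moreover have "(1 - t) * (rel_ent y + ln y * (x - y)) + t * (rel_ent y + ln y * (1 - y))
      = rel_ent y + ln y * ((1 - t) * x + t - y)"
    by (simp add: algebra_simps)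
  ultimately show ?thesis by (simp add: y_alt[symmetric] y_def[symmetric] rel_ent_def[of 1])
qed simp

text \<open>With s = sqrt x, the logarithm bound at 1 / s gives (s - 1)^2 \<le>
  \<open>rel_ent x\<close>; the other factor of (x - 1)^2 is (s + 1)^2 \<le> 2 (1 + x).\<close>

lemma rel_ent_ge_square:
  assumes "0 \<le> x"
  shows "(x - 1)\<^sup>2 \<le> 2 * (1 + x) * rel_ent x"
proof (cases "x = 0")
  case False
  then have x: "0 < x" using assms by simp
  define s where "s = sqrt x"
  have s: "0 < s" "x = s\<^sup>2" using x by (auto simp: s_def)
  have "s\<^sup>2 * (2 * (1 - 1 / s)) \<le> s\<^sup>2 * (2 * ln s)"
    using ln_le_minus_one[of "1 / s"] s by (intro mult_left_mono) (auto simp: ln_div)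
  moreover have "ln x = 2 * ln s" using s by (simp add: ln_realpow)
  ultimately have "(s - 1)\<^sup>2 \<le> rel_ent x"
    unfolding rel_ent_def using s by (simp add: power2_eq_square algebra_simps)
  moreover have "(s + 1)\<^sup>2 \<le> 2 * (1 + x)"
    using sum_squares_bound[of s 1] s by (simp add: power2_sum)
  ultimately have "(s + 1)\<^sup>2 * (s - 1)\<^sup>2 \<le> 2 * (1 + x) * rel_ent x"
    using x by (intro mult_mono) auto
  moreover have "(x - 1)\<^sup>2 = (s + 1)\<^sup>2 * (s - 1)\<^sup>2"
    by (simp add: s power2_eq_square algebra_simps)
  ultimately show ?thesis by simp
qed (simp add: rel_ent_def)

lemma abs_ln_le:
  fixes x :: real
  assumes "1 / 3 \<le> x"
  shows "\<bar>ln x\<bar> \<le> 3 * \<bar>1 - x\<bar>"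
proof -
  have x: "0 < x" using assms by simp
  have "- ln x \<le> 1 / x - 1"
    using ln_le_minus_one[of "1 / x"] x by (simp add: ln_div)
  also have "\<dots> = (1 - x) * (1 / x)" using x by (simp add: field_simps)
  also have "\<dots> \<le> \<bar>1 - x\<bar> * 3"
    using assms x by (intro mult_mono) (auto simp: field_simps)
  finally have "- ln x \<le> 3 * \<bar>1 - x\<bar>" by simp
  moreover have "x - 1 \<le> 3 * \<bar>1 - x\<bar>" by (simp add: abs_if)
  then have "ln x \<le> 3 * \<bar>1 - x\<bar>"
    using ln_le_minus_one[OF x] by (rule order_trans[rotated])
  ultimately show ?thesis by linarith
qed

text \<open>The t-mixture of x with 1 is the s-mixture of k with 1, so \<open>rel_ent\<close> drops
  by at least \<open>s * rel_ent k\<close>, which is bounded below quadratically.\<close>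

lemma rel_ent_mix_drop:
  assumes "0 \<le> x" "x \<le> a" "0 \<le> e" "e \<le> 1 / 2" "e \<le> t" "t \<le> 1"
  shows "(t - e) * (1 - x)\<^sup>2 / (4 * (2 + a))
    \<le> rel_ent (x + e * (1 - x)) - rel_ent (x + t * (1 - x))"
proof -
  define k where "k = x + e * (1 - x)"
  define s where "s = (t - e) / (1 - e)"
  have s: "0 \<le> s" "s \<le> 1" "s * (1 - e) = t - e"
    using assms by (auto simp: s_def field_simps)
  have "0 \<le> e * x" "e * x \<le> x"
    using assms by (auto intro: mult_left_le_one_le)
  moreover have k_alt: "k = x - e * x + e" by (simp add: k_def algebra_simps)
  ultimately have k: "0 \<le> k" "k \<le> 1 + a" using assms unfolding k_alt by linarith+
  have one_k: "1 - k = (1 - e) * (1 - x)" by (simp add: k_def algebra_simps)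
  have mix: "k + s * (1 - k) = x + t * (1 - x)"
    unfolding one_k mult.assoc[symmetric] s(3) by (simp add: k_def algebra_simps)
  have "(k - 1)\<^sup>2 \<le> 2 * (2 + a) * rel_ent k"
  proof -
    have "(k - 1)\<^sup>2 \<le> 2 * (1 + k) * rel_ent k" by (rule rel_ent_ge_square[OF k(1)])
    also have "\<dots> \<le> 2 * (2 + a) * rel_ent k"
      using k rel_ent_tangent[OF k(1), of 1]
      by (intro mult_right_mono) (auto simp: rel_ent_def[of 1])
    finally show ?thesis .
  qed
  then have sq: "(1 - e)\<^sup>2 * (1 - x)\<^sup>2 \<le> 2 * (2 + a) * rel_ent k"
    using one_k by (metis power2_commute power_mult_distrib)
  \<comment> \<open>The bound e \<le> 1/2 absorbs the factor 1 - e that remains from s (1 -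
    e)^2.\<close>
  have "(t - e) * (1 - x)\<^sup>2 * 1 \<le> (t - e) * (1 - x)\<^sup>2 * (2 * (1 - e))"
    using assms by (intro mult_left_mono) auto
  also have "\<dots> = 2 * s * ((1 - e)\<^sup>2 * (1 - x)\<^sup>2)"
    by (simp add: s(3)[symmetric] power2_eq_square)
  also have "\<dots> \<le> 2 * s * (2 * (2 + a) * rel_ent k)"
    using s sq by (intro mult_left_mono) auto
  finally have "(t - e) * (1 - x)\<^sup>2 / (4 * (2 + a)) \<le> s * rel_ent k"
    using assms by (simp add: field_simps)
  moreover have "rel_ent (x + t * (1 - x)) \<le> (1 - s) * rel_ent k"
    using rel_ent_mix_le[OF k(1) s(1,2)] by (simp add: mix)
  ultimately show ?thesis unfolding k_def[symmetric] left_diff_distrib by simp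
qed

lemma rel_ent_perturb:
  assumes "0 \<le> x" "0 \<le> y" "\<bar>y - x\<bar> \<le> d" "d \<le> 1 / 3"
  shows "rel_ent (x + 3 / 2 * d * (1 - x)) - rel_ent y \<le> 3 * d * \<bar>1 - x\<bar>"
proof -
  define k where "k = x + 3 / 2 * d * (1 - x)"
  have d: "0 \<le> d" using assms by linarith
  show ?thesis
  proof (cases "x < 1 / 3")
    case True
    \<comment> \<open>Here 1 - x > 2/3, so the factor 3/2 makes the shift towards 1 at least d,
      enough to reach y.\<close>
    have "3 / 2 * d * (2 / 3) \<le> 3 / 2 * d * (1 - x)"
      using True d by (intro mult_left_mono) auto
    then have "y \<le> k" using assms by (simp add: k_def)
    moreover have "k \<le> 1"
      using mult_right_mono[of "3 / 2 * d" 1 "1 - x"] True assms by (simp add: k_def)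
    ultimately have "rel_ent k \<le> rel_ent y" using assms by (intro rel_ent_antimono)
    moreover have "0 \<le> 3 * d * \<bar>1 - x\<bar>" using d by simp
    ultimately show ?thesis by (simp add: k_def)
  next
    case False
    have "rel_ent k \<le> (1 - 3 / 2 * d) * rel_ent x"
      unfolding k_def using assms d by (intro rel_ent_mix_le) auto
    also have "\<dots> \<le> rel_ent x"
      using d assms rel_ent_tangent[OF assms(1), of 1]
      by (intro mult_left_le_one_le) (auto simp: rel_ent_def[of 1])
    \<comment> \<open>The tangent is taken at x, which is at least 1/3, because y may
      vanish.\<close>
    finally have "rel_ent k - rel_ent y \<le> ln x * (x - y)"
      using rel_ent_tangent[OF assms(2), of x] False by (simp add: algebra_simps)
    also have "\<dots> \<le> \<bar>ln x\<bar> * \<bar>x - y\<bar>" by (simp add: abs_mult[symmetric])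
    also have "\<dots> \<le> (3 * \<bar>1 - x\<bar>) * d"
      using False assms by (intro mult_mono abs_ln_le) auto
    finally show ?thesis by (simp add: k_def mult_ac)
  qed
qed

lemma mix_distance_bound:
  fixes g h w :: "'i \<Rightarrow> real"
  assumes nonneg: "\<And>i. i \<in> I \<Longrightarrow> 0 \<le> w i" "\<And>i. i \<in> I \<Longrightarrow> 0 \<le> g i" "\<And>i. i \<in> I \<Longrightarrow> 0 \<le> h i"
    and bound: "\<And>i. i \<in> I \<Longrightarrow> h i \<le> a"
    and close: "\<And>i. i \<in> I \<Longrightarrow> \<bar>g i - h i\<bar> \<le> d"
    and a: "0 \<le> a" and d: "0 \<le> d" "d \<le> 1 / 3" and t: "0 \<le> t" "t \<le> 1"
    and ent: "(\<Sum>i\<in>I. rel_ent (h i + t * (1 - h i)) * w i) = (\<Sum>i\<in>I. rel_ent (g i) * w i)"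
  defines "A \<equiv> sqrt (\<Sum>i\<in>I. (1 - h i)\<^sup>2 * w i)" and "V \<equiv> (\<Sum>i\<in>I. w i)"
  shows "t * A \<le> 15 * (2 + a) * sqrt V * d"
proof -
  define e where "e = 3 / 2 * d"
  have A0: "0 \<le> A" unfolding A_def using nonneg by (intro real_sqrt_ge_zero sum_nonneg) auto
  have A_sq: "A\<^sup>2 = (\<Sum>i\<in>I. (1 - h i)\<^sup>2 * w i)"
    unfolding A_def using nonneg by (intro real_sqrt_pow2 sum_nonneg) auto
  have V0: "0 \<le> V" unfolding V_def using nonneg by (intro sum_nonneg)
  \<comment> \<open>This crude bound on A controls the first part \<open>e * A\<close> of the
    displacement.\<close>
  have "A \<le> sqrt ((1 + a)\<^sup>2 * V)"
    unfolding A_def V_def sum_distrib_left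
  proof (intro real_sqrt_le_mono sum_mono mult_right_mono)
    fix i assume i: "i \<in> I"
    show "(1 - h i)\<^sup>2 \<le> (1 + a)\<^sup>2"
      using nonneg(3)[OF i] bound[OF i] by (intro abs_le_square_iff[THEN iffD1]) auto
  qed (use nonneg in auto)
  then have A_le: "A \<le> (1 + a) * sqrt V" using a by (simp add: real_sqrt_mult)
  have "(t - e) * A \<le> 12 * (2 + a) * sqrt V * d"
  proof (cases "e < t \<and> 0 < A")
    case False
    then have "(t - e) * A \<le> 0" using A0 by (auto simp: not_less mult_nonpos_nonneg)
    also have "\<dots> \<le> 12 * (2 + a) * sqrt V * d" using a d V0 by simp
    finally show ?thesis .
  next
    case True
    \<comment> \<open>Cauchy-Schwarz, with each weight split into two square roots.\<close>
    have cs: "(\<Sum>i\<in>I. \<bar>1 - h i\<bar> * w i) \<le> A * sqrt V"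
    proof -
      have "(\<Sum>i\<in>I. \<bar>1 - h i\<bar> * w i)
          = (\<Sum>i\<in>I. \<bar>(1 - h i) * sqrt (w i)\<bar> * \<bar>sqrt (w i)\<bar>)"
        using nonneg(1) by (intro sum.cong refl) (auto simp: abs_mult)
      also have "\<dots> \<le> L2_set (\<lambda>i. (1 - h i) * sqrt (w i)) I * L2_set (\<lambda>i. sqrt (w i)) I"
        by (rule L2_set_mult_ineq)
      also have "\<dots> = A * sqrt V"
        unfolding L2_set_def A_def V_def using nonneg(1)
        by (intro arg_cong2[where f = "(*)"] arg_cong[where f = sqrt] sum.cong refl)
           (auto simp: power_mult_distrib)
      finally show ?thesis .
    qed
    have "(t - e) * A\<^sup>2 / (4 * (2 + a))
        = (\<Sum>i\<in>I. (t - e) * (1 - h i)\<^sup>2 / (4 * (2 + a)) * w i)"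
      unfolding A_sq by (simp add: sum_distrib_left sum_divide_distrib mult_ac)
    also have "\<dots> \<le> (\<Sum>i\<in>I. (rel_ent (g i) - rel_ent (h i + t * (1 - h i)) + 3 * d * \<bar>1 - h i\<bar>) * w i)"
    proof (intro sum_mono mult_right_mono)
      fix i assume i: "i \<in> I"
      have "(t - e) * (1 - h i)\<^sup>2 / (4 * (2 + a))
          \<le> rel_ent (h i + e * (1 - h i)) - rel_ent (h i + t * (1 - h i))"
        using nonneg(3)[OF i] bound[OF i] True t d by (intro rel_ent_mix_drop) (auto simp: e_def)
      moreover have "rel_ent (h i + e * (1 - h i)) - rel_ent (g i) \<le> 3 * d * \<bar>1 - h i\<bar>"
        unfolding e_def using nonneg(2,3)[OF i] close[OF i] d(2) by (intro rel_ent_perturb)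
      ultimately show "(t - e) * (1 - h i)\<^sup>2 / (4 * (2 + a))
          \<le> rel_ent (g i) - rel_ent (h i + t * (1 - h i)) + 3 * d * \<bar>1 - h i\<bar>" by simp
    qed (use nonneg in auto)
    \<comment> \<open>The \<open>rel_ent\<close> differences cancel in the sum by
      \<open>ent\<close>.\<close>
    also have "\<dots> = 3 * d * (\<Sum>i\<in>I. \<bar>1 - h i\<bar> * w i)"
      using ent by (simp add: algebra_simps sum.distrib sum_subtractf sum_distrib_left)
    also have "\<dots> \<le> 3 * d * (A * sqrt V)"
      using cs d by (intro mult_left_mono) auto
    finally have "A * ((t - e) * A) \<le> A * (12 * (2 + a) * sqrt V * d)"
      using a by (simp add: field_simps power2_eq_square)
    then show ?thesis using True by simp
  qed
  moreover have "e * A \<le> 3 / 2 * d * ((2 + a) * sqrt V)"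
  proof -
    have "(1 + a) * sqrt V \<le> (2 + a) * sqrt V" using V0 by (intro mult_right_mono) auto
    then show ?thesis unfolding e_def using A_le d by (intro mult_left_mono) auto
  qed
  moreover have "0 \<le> d * ((2 + a) * sqrt V)" using d a V0 by simp
  \<comment> \<open>The constants 12 and 3/2 add up to less than 15.\<close>
  ultimately show ?thesis by (simp add: algebra_simps)
qed

section \<open>Translation to weighted vector norms and entropies\<close>

lemma sup_norm_ge: "i < dim_vec f \<Longrightarrow> \<bar>f $ i\<bar> \<le> sup_norm f"
  by (simp add: sup_norm_def)

lemma weighted_norm_1_nonneg:
  assumes "f \<in> nonneg_vecs (dim_vec w)"
  shows "weighted_norm 1 w f = mass w f"
  using assms by (auto simp: weighted_norm_def mass_def nonneg_vecs_def intro!: sum.cong)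

text \<open>For vectors of equal mass, this turns equality of entropies into equality of
  \<open>rel_ent\<close> sums.\<close>

lemma sum_rel_ent:
  "(\<Sum>i<dim_vec w. rel_ent (f $ i) * w $ i) = entropy w f - mass w f + volume w"
  by (simp add: rel_ent_def entropy_def mass_def volume_def algebra_simps sum.distrib sum_subtractf)

lemma weighted_norm_mix_bound:
  assumes w: "w \<in> pos_vecs N" and N: "1 \<le> N"
    and g: "g \<in> nonneg_vecs N" and h: "h \<in> nonneg_vecs N"
    and mass: "mass w g = volume w" "mass w h = volume w"
    and t: "0 \<le> t" "t \<le> 1"
    and ent: "entropy w (h + t \<cdot>\<^sub>v (ones_vec N - h)) = entropy w g"
    and close: "sup_norm (g - h) \<le> 1 / 3"
  shows "weighted_norm 2 w (t \<cdot>\<^sub>v (ones_vec N - h))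
    \<le> 15 * (2 + sup_norm h) * sqrt (volume w) * sup_norm (g - h)"
proof -
  have dims: "dim_vec w = N" "dim_vec g = N" "dim_vec h = N"
    using w g h by (auto simp: pos_vecs_def nonneg_vecs_def)
  have comp: "(h + t \<cdot>\<^sub>v (ones_vec N - h)) $ i = h $ i + t * (1 - h $ i)"
    "(t \<cdot>\<^sub>v (ones_vec N - h)) $ i = t * (1 - h $ i)" if "i < N" for i
    using that dims by (auto simp: ones_vec_def)
  \<comment> \<open>Mixing with the ones vector keeps the mass, since both vectors have mass
    \<open>volume w\<close>.\<close>
  have mass_mix: "mass w (h + t \<cdot>\<^sub>v (ones_vec N - h)) = volume w"
  proof -
    have "mass w (h + t \<cdot>\<^sub>v (ones_vec N - h)) = (\<Sum>i<N. (h $ i + t * (1 - h $ i)) * w $ i)"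
      unfolding mass_def dims by (intro sum.cong refl) (simp only: comp lessThan_iff)
    also have "\<dots> = mass w h + t * (volume w - mass w h)"
      by (simp add: mass_def volume_def dims algebra_simps sum.distrib sum_subtractf
          sum_distrib_left)
    finally show ?thesis by (simp add: mass)
  qed
  have "(\<Sum>i<N. rel_ent (h $ i + t * (1 - h $ i)) * w $ i)
      = (\<Sum>i<dim_vec w. rel_ent ((h + t \<cdot>\<^sub>v (ones_vec N - h)) $ i) * w $ i)"
    unfolding dims by (intro sum.cong refl) (simp only: comp lessThan_iff)
  also have "\<dots> = (\<Sum>i<N. rel_ent (g $ i) * w $ i)"
    unfolding sum_rel_ent mass_mix ent using sum_rel_ent[where w = w and f = g]
    by (simp add: mass dims)
  finally have rel: "(\<Sum>i<N. rel_ent (h $ i + t * (1 - h $ i)) * w $ i)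
      = (\<Sum>i<N. rel_ent (g $ i) * w $ i)" .
  have close_i: "\<bar>g $ i - h $ i\<bar> \<le> sup_norm (g - h)" if "i < N" for i
    using sup_norm_ge[of i "g - h"] that dims by simp
  have bound_i: "h $ i \<le> sup_norm h" if "i < N" for i
    using sup_norm_ge[of i h] that dims by simp
  have "t * sqrt (\<Sum>i<N. (1 - h $ i)\<^sup>2 * w $ i)
      \<le> 15 * (2 + sup_norm h) * sqrt (\<Sum>i<N. w $ i) * sup_norm (g - h)"
  proof (rule mix_distance_bound[where g = "\<lambda>i. g $ i"])
    show "0 \<le> sup_norm h" using sup_norm_ge[of 0 h] N dims by simp
    show "0 \<le> sup_norm (g - h)" using close_i[of 0] N by linarith
  qed (use w g h close_i bound_i close t rel in
      \<open>auto simp: pos_vecs_def nonneg_vecs_def less_imp_le\<close>)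
  moreover have "weighted_norm 2 w (t \<cdot>\<^sub>v (ones_vec N - h))
      = t * sqrt (\<Sum>i<N. (1 - h $ i)\<^sup>2 * w $ i)"
  proof -
    have "(\<Sum>i<N. \<bar>(t \<cdot>\<^sub>v (ones_vec N - h)) $ i\<bar>\<^sup>2 * w $ i)
        = (\<Sum>i<N. t\<^sup>2 * ((1 - h $ i)\<^sup>2 * w $ i))"
      by (intro sum.cong refl) (simp only: comp lessThan_iff power2_abs power_mult_distrib mult.assoc)
    then show ?thesis
      using t by (simp add: weighted_norm_def dims sqrt_def[symmetric] sum_distrib_left[symmetric]
          real_sqrt_mult)
  qed
  ultimately show ?thesis by (simp add: volume_def dims)
qed

theorem theorem2p4:
  shows "\<exists>M :: real \<Rightarrow> real \<Rightarrow> real \<Rightarrow> real.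
    (\<forall>V a b. 0 < M V a b) \<and>
    (\<forall>(N :: nat) (w :: real vec) (Q :: nat \<Rightarrow> real vec \<Rightarrow> real) (t0 :: real) (t1 :: real)
      (f :: real \<Rightarrow> real vec) (f0 :: real vec) (f1 :: real vec) (\<beta> :: real).
      1 \<le> N \<and> w \<in> pos_vecs N \<and>
      structure_preserving w Q \<and>
      t0 < t1 \<and> ode_solution N Q t0 t1 f \<and> f t0 = f0 \<and>
      f0 \<in> nonneg_vecs N \<and> weighted_norm 1 w f0 = volume w \<and>
      f1 \<in> nonneg_vecs N \<and>
      weighted_norm 1 w f1 = weighted_norm 1 w (f t1) \<and> weighted_norm 1 w (f t1) = volume w \<and>
      entropy w f1 > entropy w f0 \<and>
      0 < \<beta> \<and> \<beta> \<le> 1 \<and>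
      entropy w (f1 + \<beta> \<cdot>\<^sub>v (ones_vec N - f1)) = entropy w (f t1) \<and>
      sup_norm (f t1 - f1) \<le> 1 / 3
      \<longrightarrow> weighted_norm 2 w (\<beta> \<cdot>\<^sub>v (ones_vec N - f1))
          \<le> M (volume w) (sup_norm f1) (sup_norm (f t1)) * sup_norm (f t1 - f1))"
\<comment> \<open>The absolute values and the summand 1 make M positive at all real arguments,
  including negative ones.\<close>
proof (intro exI[of _ "\<lambda>V a _. 1 + 15 * (2 + \<bar>a\<bar>) * sqrt \<bar>V\<bar>"] conjI allI impI, goal_cases)
  case (1 V a b)
  show ?case by (intro add_pos_nonneg) auto
next
  case (2 N w Q t0 t1 f f0 f1 \<beta>)
  then have w: "w \<in> pos_vecs N" "dim_vec w = N" and N: "1 \<le> N" and f1: "f1 \<in> nonneg_vecs N"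
    by (auto simp: pos_vecs_def)
  \<comment> \<open>Nonnegativity of the exact solution identifies its weighted 1-norm with its
    mass.\<close>
  have ft1: "f t1 \<in> nonneg_vecs N"
  proof -
    have "\<forall>t\<in>{t0..t1}. f t \<in> nonneg_vecs (dim_vec w)"
      using 2 w(2) unfolding structure_preserving_def by blast
    then show ?thesis using 2 w(2) by simp
  qed
  have "0 \<le> volume w"
    unfolding volume_def using w by (intro sum_nonneg) (auto simp: pos_vecs_def less_imp_le)
  moreover have dims: "dim_vec f1 = N" "dim_vec (f t1) = N"
    using f1 ft1 by (auto simp: nonneg_vecs_def)
  have "0 \<le> sup_norm f1" "0 \<le> sup_norm (f t1 - f1)"
    using sup_norm_ge[of 0 f1] sup_norm_ge[of 0 "f t1 - f1"] N dims by auto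
  moreover have "weighted_norm 2 w (\<beta> \<cdot>\<^sub>v (ones_vec N - f1))
      \<le> 15 * (2 + sup_norm f1) * sqrt (volume w) * sup_norm (f t1 - f1)"
    using 2 w f1 ft1 weighted_norm_1_nonneg[of f1 w] weighted_norm_1_nonneg[of "f t1" w]
    by (intro weighted_norm_mix_bound) auto
  ultimately show ?case by (simp add: algebra_simps)
qed

end
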